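(* Let $0<H<1$, $1-H<\alpha<1$, let $B^H$ be a (continuous) fractional Brownian motion with Hurst index $H$, and for $0\le t_2<t_1$ put $$X(t_1,t_2)=\frac{B^H_{t_1}-B^H_{t_2}}{(t_1-t_2)^{1-\alpha}}+\int_{t_2}^{t_1}\frac{B^H_u-B^H_{t_2}}{(u-t_2)^{2-\alpha}}\,du.$$ Then for every $p>1$ there exists a random variable $\xi=\xi(p)$ such that for all $0\le t_2<t_1$, $$|X(t_1,t_2)|\le \big((t_1^{H+\alpha-1}|\log t_1|^p)\vee 1\big)\,\xi(p),$$ and $\xi(p)$ has a Gaussian-type tail: there exist constants $B_1>0$, $C_1>0$, $\gamma>0$ and $\kappa\in(0,1)$ with $\kappa<2\gamma$ such that for all $\varepsilon>(2C_1+1)^{\frac{2\gamma}{2\gamma+\kappa}}$, $P\{\xi(p)>\varepsilon\}\le 2\exp\Big\{-\frac{(\varepsilon-\varepsilon^{\frac{\kappa}{2\gamma+\kappa}}(2C_1+1))^2}{2B_1^2}\Big\}$ (in particular $\xi(p)<\infty$ a.s.).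
   Context: A fractional Brownian motion with Hurst index $H\in(0,1)$ is a centered Gaussian process $B^H=\{B^H_t,t\ge0\}$ with $B^H_0=0$ and $EB^H_tB^H_s=\frac12(t^{2H}+s^{2H}-|t-s|^{2H})$; its continuous modification is used. Up to a constant factor, $X(t_1,t_2)$ is the Weyl–Marchaud fractional derivative $(\mathcal D^{1-\alpha}_{t_1-}B^H_{t_1-})(t_2)$. *)

theory Defs
  imports "HOL-Probability.Probability"
begin

definition fbm_cov :: "real \<Rightarrow> real \<Rightarrow> real \<Rightarrow> real" where
  "fbm_cov H t s = (t powr (2*H) + s powr (2*H) - \<bar>t - s\<bar> powr (2*H)) / 2"

definition gaussian_rv :: "'a measure \<Rightarrow> ('a \<Rightarrow> real) \<Rightarrow> real \<Rightarrow> real \<Rightarrow> bool" where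
  "gaussian_rv M Y mu s2 \<longleftrightarrow>
     (s2 > 0 \<and> distributed M lborel Y (normal_density mu (sqrt s2))) \<or>
     (s2 = 0 \<and> Y \<in> borel_measurable M \<and> (AE \<omega> in M. Y \<omega> = mu))"

text \<open>B is a continuous fractional Brownian motion with Hurst index H on the probability
  space M: a centered Gaussian process on [0,oo) (every finite linear combination is
  centered normal with the variance dictated by the covariance), with B 0 = 0 a.s.
  (implied by the covariance) and all sample paths continuous on [0,oo).\<close>
definition is_fbm :: "'a measure \<Rightarrow> real \<Rightarrow> (real \<Rightarrow> 'a \<Rightarrow> real) \<Rightarrow> bool" where
  "is_fbm M H B \<longleftrightarrow>
     prob_space M \<and>
     (\<forall>t\<ge>0. B t \<in> borel_measurable M) \<and>
     (\<forall>(n::nat) (ts::nat \<Rightarrow> real) (cs::nat \<Rightarrow> real). (\<forall>i<n. ts i \<ge> 0) \<longrightarrow>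
        gaussian_rv M (\<lambda>\<omega>. \<Sum>i<n. cs i * B (ts i) \<omega>) 0
          (\<Sum>i<n. \<Sum>j<n. cs i * cs j * fbm_cov H (ts i) (ts j))) \<and>
     (\<forall>\<omega>\<in>space M. continuous_on {0..} (\<lambda>t. B t \<omega>))"

definition fbm_X :: "real \<Rightarrow> (real \<Rightarrow> 'a \<Rightarrow> real) \<Rightarrow> real \<Rightarrow> real \<Rightarrow> 'a \<Rightarrow> real" where
  "fbm_X \<alpha> B t1 t2 \<omega> =
     (B t1 \<omega> - B t2 \<omega>) / (t1 - t2) powr (1 - \<alpha>) +
     (\<integral>u\<in>{t2..t1}. (B u \<omega> - B t2 \<omega>) / (u - t2) powr (2 - \<alpha>) \<partial>lborel)"

end

theory Submission
  imports Defs
begin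

text \<open>Fix \<open>1 - \<alpha> < \<beta> < H\<close>. If a path is \<open>\<beta>\<close>-Hoelder on \<open>[0, T]\<close> with constant \<open>K T\<^sup>H\<^sup>-\<^sup>\<beta>\<close>, integrating this
  modulus bounds \<open>X(t\<^sub>1, t\<^sub>2)\<close> by a multiple of \<open>K T\<^sup>H\<^sup>+\<^sup>\<alpha>\<^sup>-\<^sup>1\<close>. By Kolmogorov's chaining argument \<open>K\<close> is
  controlled by the increments over the dyadic intervals of length \<open>T / 2\<^sup>n\<close>, normalised to standard
  Gaussians and divided by \<open>2\<^bsup>n(H - \<beta>)\<^esup>\<close>. Hence one may take for \<open>\<xi>\<close> a multiple of the supremum of
  these quantities over all horizons \<open>T = 2\<^bsup>m+1\<^esup>\<close>, the \<open>m\<close>-th of which is further divided by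
  \<open>(m + 1)\<^sup>p\<close>, which accounts for the logarithm. A union bound gives \<open>\<xi>\<close> a sub-Gaussian tail, and a
  large \<open>B\<^sub>1\<close> turns any such tail into the required form.\<close>

section \<open>Hoelder continuity from dyadic increments\<close>

text \<open>Kolmogorov's chaining for a single path: every point is the limit of its dyadic floors,
  and consecutive floors coincide or differ by one dyadic interval, so the telescoping sum is
  geometric. Comparing two points at the level of their distance costs two such tails and one
  increment, hence \<open>1 + 2 / (1 - q)\<close>; rounding the distance to a power of 2 costs
  \<open>2 powr \<beta>\<close>.\<close>

lemma dyadic_increments_imp_holder:
  fixes g :: "real \<Rightarrow> real" and \<beta> L x y :: real
  defines "q \<equiv> 2 powr - \<beta>"
  assumes beta: "\<beta> > 0" and cont: "continuous_on {0..1} g"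
    and incr: "\<And>(n::nat) (k::nat). k < (2::nat) ^ n \<Longrightarrow> \<bar>g ((real k + 1) / 2 ^ n) - g (real k / 2 ^ n)\<bar> \<le> L * q ^ n"
    and xy: "x \<in> {0..1}" "y \<in> {0..1}"
  shows "\<bar>g x - g y\<bar> \<le> L * ((1 + 2 / (1 - q)) * 2 powr \<beta>) * \<bar>x - y\<bar> powr \<beta>"
proof -
  have q: "0 < q" "q < 1"
    using beta powr_less_cancel_iff[of 2 "-\<beta>" 0] by (auto simp: q_def)
  have L: "L \<ge> 0"
    using incr[of 0 0] by simp
  define e where "e = (\<lambda>(n::nat) (z::real). nat \<lfloor>2 ^ n * z\<rfloor>)"
  define d where "d = (\<lambda>n z. e n z / 2 ^ n)"
  have e_real: "real (e n z) = of_int \<lfloor>2 ^ n * z\<rfloor>" if "z \<in> {0..1}" for n z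
    using that by (simp add: e_def)
  have e_bounds: "e n z \<le> 2 ^ n * z" "2 ^ n * z < real (e n z) + 1" if "z \<in> {0..1}" for n and z :: real
    unfolding e_real[OF that] by linarith+
  have e_le: "e n z \<le> 2 ^ n" if "z \<in> {0..1}" for n z
  proof -
    have "e n z \<le> (2 ^ n * z :: real)" using e_bounds that by blast
    also have "\<dots> \<le> 2 ^ n" using that by simp
    finally show ?thesis by (metis of_nat_le_iff of_nat_numeral of_nat_power)
  qed
  have d_in: "d n z \<in> {0..1}" if "z \<in> {0..1}" for n z
  proof -
    have "real (e n z) \<le> 2 ^ n" using e_le[OF that, of n] by (metis of_nat_le_iff of_nat_numeral of_nat_power)
    then show ?thesis by (simp add: d_def)
  qed
  have step: "\<bar>g (d (Suc n) z) - g (d n z)\<bar> \<le> L * q ^ Suc n" if z: "z \<in> {0..1}" for n z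
  proof -
    \<comment> \<open>Passing to the next level appends one binary digit of
      \<open>z\<close>.\<close>
    have "e (Suc n) z = 2 * e n z \<or> e (Suc n) z = 2 * e n z + 1"
    proof -
      have "real (e (Suc n) z) < real (2 * e n z + 2)"
        using e_bounds[OF z, of n] e_bounds[OF z, of "Suc n"] by simp
      moreover have "real (2 * e n z) < real (e (Suc n) z + 1)"
        using e_bounds[OF z, of n] e_bounds[OF z, of "Suc n"] by simp
      ultimately show ?thesis unfolding of_nat_less_iff by linarith
    qed
    moreover have "d n z = real (2 * e n z) / 2 ^ Suc n"
      by (simp add: d_def)
    moreover have "0 \<le> L * q ^ Suc n"
      using L q by simp
    \<comment> \<open>At \<open>z = 1\<close> the floor index is \<open>2 ^ n\<close>, outside the
      range of \<open>incr\<close>; but a new digit 1 can only occur strictly below the right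
      end.\<close>
    moreover have "2 * e n z < 2 ^ Suc n" if "e (Suc n) z = 2 * e n z + 1"
      using e_le[OF z, of "Suc n"] that by simp
    ultimately show ?thesis
      using incr[of "2 * e n z" "Suc n"] by (auto simp: d_def add.commute)
  qed
  \<comment> \<open>The right-hand side is an exact geometric partial sum; the factor
    \<open>1 - q ^ j\<close> is what lets the induction close.\<close>
  have chain: "\<bar>g (d (n + j) z) - g (d n z)\<bar> \<le> L * q ^ n / (1 - q) * (1 - q ^ j)"
    if z: "z \<in> {0..1}" for n j z
  proof (induction j)
    case (Suc j)
    have "\<bar>g (d (n + Suc j) z) - g (d n z)\<bar>
      \<le> \<bar>g (d (Suc (n + j)) z) - g (d (n + j) z)\<bar> + \<bar>g (d (n + j) z) - g (d n z)\<bar>"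
      by simp
    also have "\<dots> \<le> L * q ^ Suc (n + j) + L * q ^ n / (1 - q) * (1 - q ^ j)"
      using Suc step[OF z] by (intro add_mono)
    also have "\<dots> \<le> L * q ^ (n + j) + L * q ^ n / (1 - q) * (1 - q ^ j)"
      using q L by (intro add_mono mult_left_mono power_decreasing) auto
    also have "\<dots> = L * q ^ n / (1 - q) * (1 - q ^ Suc j)"
      using q by (simp add: field_simps power_add)
    finally show ?case .
  qed simp
  have d_lim: "(\<lambda>j. d j z) \<longlonglongrightarrow> z" if z: "z \<in> {0..1}" for z
  proof (rule tendsto_sandwich[of "\<lambda>j. z - 1 / 2 ^ j" _ _ "\<lambda>_. z"])
    show "\<forall>\<^sub>F n in sequentially. z - 1 / 2 ^ n \<le> d n z"
    proof (intro always_eventually allI)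
      fix n
      have "z < (real (e n z) + 1) / 2 ^ n"
        using e_bounds[OF z, of n] by (simp add: pos_less_divide_eq mult.commute)
      then show "z - 1 / 2 ^ n \<le> d n z" by (simp add: d_def add_divide_distrib)
    qed
    show "\<forall>\<^sub>F n in sequentially. d n z \<le> z"
      using e_bounds[OF z] by (intro always_eventually allI) (simp add: d_def field_simps)
    have "(\<lambda>j. z - (1 / 2) ^ j) \<longlonglongrightarrow> z - 0"
      by (intro tendsto_intros) auto
    then show "(\<lambda>j. z - 1 / 2 ^ j) \<longlonglongrightarrow> z"
      by (simp add: power_one_over)
  qed simp
  have limit: "\<bar>g z - g (d n z)\<bar> \<le> L * q ^ n / (1 - q)" if z: "z \<in> {0..1}" for n z
  proof (rule LIMSEQ_le_const2)
    have "(\<lambda>j. g (d j z)) \<longlonglongrightarrow> g z"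
      using continuous_on_tendsto_compose[OF cont d_lim[OF z] z] d_in[OF z] by simp
    then have "(\<lambda>j. g (d (j + n) z)) \<longlonglongrightarrow> g z"
      by (rule LIMSEQ_ignore_initial_segment)
    then show "(\<lambda>j. \<bar>g (d (n + j) z) - g (d n z)\<bar>) \<longlonglongrightarrow> \<bar>g z - g (d n z)\<bar>"
      by (intro tendsto_intros) (simp add: add.commute)
    have "L * q ^ n / (1 - q) * (1 - q ^ j) \<le> L * q ^ n / (1 - q) * 1" for j
      using L q by (intro mult_left_mono) auto
    then show "\<exists>N. \<forall>j\<ge>N. \<bar>g (d (n + j) z) - g (d n z)\<bar> \<le> L * q ^ n / (1 - q)"
      using chain[OF z] by (metis mult.right_neutral order_trans)
  qed
  have main: "\<bar>g x - g y\<bar> \<le> L * ((1 + 2 / (1 - q)) * 2 powr \<beta>) * \<bar>x - y\<bar> powr \<beta>"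
    if xy: "x \<in> {0..1}" "y \<in> {0..1}" "x < y" for x y
  proof -
    have "\<exists>n. (1 / 2 :: real) ^ n < y - x"
      using real_arch_pow_inv[of "y - x" "1/2"] xy by simp
    \<comment> \<open>With \<open>n = m - 1\<close>, the distance lies above
      \<open>(1/2) ^ (n + 1)\<close> and is at most \<open>(1/2) ^ n\<close>. The upper bound makes
      the floors at level \<open>n\<close> equal or adjacent; the lower bound turns
      \<open>q ^ n\<close> into a power of the distance.\<close>
    then obtain m where m: "(1 / 2) ^ m < y - x" "\<And>i. i < m \<Longrightarrow> \<not> (1 / 2) ^ i < y - x"
      using exists_least_iff[of "\<lambda>n. (1 / 2) ^ n < y - x"] by blast
    have "m \<noteq> 0" using m(1) xy by (cases m) auto
    then obtain n where n: "m = Suc n" by (cases m) auto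
    have lo: "(1 / 2) ^ Suc n < y - x" and hi: "2 ^ n * (y - x) \<le> 1"
      using m(1) m(2)[of n] by (simp_all add: n field_simps)
    have "e n y = e n x \<or> e n y = e n x + 1"
    proof -
      have "(2::real) ^ n * x \<le> 2 ^ n * y" using xy by simp
      then have "real (e n x) < real (e n y + 1)"
        using e_bounds[OF xy(1), of n] e_bounds[OF xy(2), of n] by linarith
      moreover have "real (e n y) < real (e n x + 2)"
        using e_bounds[OF xy(1), of n] e_bounds[OF xy(2), of n] hi
        by (simp add: algebra_simps)
      ultimately show ?thesis unfolding of_nat_less_iff by linarith
    qed
    moreover have "0 \<le> L * q ^ n"
      using L q by simp
    moreover have "e n x < 2 ^ n" if "e n y = e n x + 1"
      using e_le[OF xy(2), of n] that by simp
    ultimately have "\<bar>g (d n y) - g (d n x)\<bar> \<le> L * q ^ n"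
      using incr[of "e n x" n] by (auto simp: d_def add.commute)
    then have "\<bar>g x - g y\<bar> \<le> L * q ^ n + 2 * (L * q ^ n / (1 - q))"
      using limit[OF xy(1), of n] limit[OF xy(2), of n] by linarith
    also have "\<dots> = L * (1 + 2 / (1 - q)) * q ^ n"
      by (simp add: field_simps)
    also have "\<dots> \<le> L * (1 + 2 / (1 - q)) * (2 powr \<beta> * (y - x) powr \<beta>)"
    proof (rule mult_left_mono)
      have "(1 / 2 :: real) ^ n = 2 powr (- real n)"
        by (simp add: powr_minus_divide powr_realpow power_one_over)
      then have "q ^ n = ((1/2) ^ n) powr \<beta>"
        by (simp add: q_def powr_power powr_powr mult.commute)
      also have "\<dots> = 2 powr \<beta> * ((1/2) ^ Suc n) powr \<beta>"
        by (simp flip: powr_mult)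
      also have "\<dots> \<le> 2 powr \<beta> * (y - x) powr \<beta>"
        using lo beta by (intro mult_left_mono powr_mono2) auto
      finally show "q ^ n \<le> 2 powr \<beta> * (y - x) powr \<beta>" .
    qed (use L q in auto)
    finally show ?thesis
      using xy by (simp add: mult_ac)
  qed
  show ?thesis
    using main[of x y] main[of y x] xy
    by (cases x y rule: linorder_cases) (auto simp: abs_minus_commute)
qed

section \<open>Bounding \<open>fbm_X\<close> along a Hoelder path\<close>

lemma has_integral_powr_shift:
  fixes a t s :: real
  assumes "s \<le> t" "a > -1"
  shows "((\<lambda>u. (u - s) powr a) has_integral (t - s) powr (a + 1) / (a + 1)) {s..t}"
proof -
  have "((\<lambda>u. u powr a) has_integral ((t - s) powr (a + 1) / (a + 1))) (cbox 0 (t - s))"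
    using has_integral_powr_from_0[of a "t - s"] assms by simp
  from has_integral_affinity'[OF this, of 1 "-s"] show ?thesis
    by simp
qed

text \<open>The modulus dominates the integrand by
  \<open>K * (u - s) powr (\<beta> + \<alpha> - 2)\<close>, a singularity that is integrable exactly
  because the exponent exceeds -1. Its integral contributes
  \<open>1 / (\<beta> + \<alpha> - 1)\<close> to the constant, the boundary term contributes
  1.\<close>

lemma abs_fbm_X_le:
  fixes s t :: real
  assumes "s < t" "\<beta> + \<alpha> > 1" and
    hoelder: "\<And>u. u \<in> {s..t} \<Longrightarrow> \<bar>B u \<omega> - B s \<omega>\<bar> \<le> K * (u - s) powr \<beta>"
  shows "\<bar>fbm_X \<alpha> B t s \<omega>\<bar> \<le> K * (1 + 1 / (\<beta> + \<alpha> - 1)) * (t - s) powr (\<beta> + \<alpha> - 1)"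
proof -
  have quot: "\<bar>(B u \<omega> - B s \<omega>) / (u - s) powr c\<bar> \<le> K * (u - s) powr (\<beta> - c)" if "u \<in> {s..t}" for u c
  proof -
    have "\<bar>(B u \<omega> - B s \<omega>) / (u - s) powr c\<bar> = \<bar>B u \<omega> - B s \<omega>\<bar> / (u - s) powr c"
      by simp
    also have "\<dots> \<le> K * (u - s) powr \<beta> / (u - s) powr c"
      using hoelder[OF that] by (intro divide_right_mono) auto
    finally show ?thesis by (simp add: powr_diff)
  qed
  define h where "h = (\<lambda>u. indicator {s..t} u * (K * (u - s) powr (\<beta> + \<alpha> - 2)))"
  have K: "K \<ge> 0"
    using order_trans[OF abs_ge_zero hoelder[of t]] assms by (simp add: zero_le_mult_iff)
  have HK: "((\<lambda>u. K * (u - s) powr (\<beta> + \<alpha> - 2)) has_integral K * ((t - s) powr (\<beta> + \<alpha> - 1) / (\<beta> + \<alpha> - 1))) {s..t}"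
    using has_integral_mult_right[OF has_integral_powr_shift[of s t "\<beta> + \<alpha> - 2"], of K] assms
    by simp
  have "(h has_integral K * ((t - s) powr (\<beta> + \<alpha> - 1) / (\<beta> + \<alpha> - 1))) UNIV"
    using has_integral_restrict_UNIV[THEN iffD2, OF HK]
    by (rule has_integral_eq[rotated]) (auto simp: h_def)
  then have "(\<integral>\<^sup>+u. ennreal (h u) \<partial>lborel) = ennreal (K * ((t - s) powr (\<beta> + \<alpha> - 1) / (\<beta> + \<alpha> - 1)))"
    using K by (intro nn_integral_has_integral_lborel) (auto simp: h_def)
  then have "has_bochner_integral lborel h (K * ((t - s) powr (\<beta> + \<alpha> - 1) / (\<beta> + \<alpha> - 1)))"
    using K assms by (intro has_bochner_integral_nn_integral) (auto simp: h_def)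
  then have h: "integrable lborel h" "integral\<^sup>L lborel h = K * ((t - s) powr (\<beta> + \<alpha> - 1) / (\<beta> + \<alpha> - 1))"
    by (simp_all add: has_bochner_integral_iff)
  have "\<bar>\<integral>u\<in>{s..t}. (B u \<omega> - B s \<omega>) / (u - s) powr (2 - \<alpha>) \<partial>lborel\<bar>
      \<le> (\<integral>u. \<bar>indicator {s..t} u * ((B u \<omega> - B s \<omega>) / (u - s) powr (2 - \<alpha>))\<bar> \<partial>lborel)"
    unfolding set_lebesgue_integral_def real_scaleR_def by (rule integral_abs_bound)
  \<comment> \<open>A nonintegrable function has integral 0 by convention, so domination by the
    integrable and nonnegative \<open>h\<close> suffices here.\<close>
  also have "\<dots> \<le> integral\<^sup>L lborel h"
    using h(1)
  proof (rule integral_mono')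
    fix u
    show "\<bar>indicator {s..t} u * ((B u \<omega> - B s \<omega>) / (u - s) powr (2 - \<alpha>))\<bar> \<le> h u"
      using quot[of u "2 - \<alpha>"] by (auto simp: h_def indicator_def algebra_simps)
    show "0 \<le> h u" using K by (simp add: h_def)
  qed
  finally have "\<bar>\<integral>u\<in>{s..t}. (B u \<omega> - B s \<omega>) / (u - s) powr (2 - \<alpha>) \<partial>lborel\<bar>
    \<le> K * ((t - s) powr (\<beta> + \<alpha> - 1) / (\<beta> + \<alpha> - 1))"
    by (simp add: h)
  moreover have "\<bar>(B t \<omega> - B s \<omega>) / (t - s) powr (1 - \<alpha>)\<bar> \<le> K * (t - s) powr (\<beta> + \<alpha> - 1)"
    using quot[of t "1 - \<alpha>"] assms by (simp add: algebra_simps)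
  ultimately have "\<bar>fbm_X \<alpha> B t s \<omega>\<bar> \<le> K * (t - s) powr (\<beta> + \<alpha> - 1)
     + K * ((t - s) powr (\<beta> + \<alpha> - 1) / (\<beta> + \<alpha> - 1))"
    unfolding fbm_X_def by linarith
  then show ?thesis by (simp add: algebra_simps)
qed

section \<open>Gaussian tails of the increments\<close>

text \<open>Half of the exponent is spent on the tail: where |y| > \<sigma> x, the density is at
  most \<open>exp (- x\<^sup>2 / 4)\<close> times sqrt 2 times the normal density with doubled
  variance, which integrates to 1. The factor sqrt 2 is rounded up to 2.\<close>

lemma (in prob_space) normal_tail:
  assumes D: "distributed M lborel Y (normal_density 0 \<sigma>)" and \<sigma>: "\<sigma> > 0" and x: "x \<ge> 0"
  shows "prob {\<omega> \<in> space M. \<bar>Y \<omega>\<bar> > \<sigma> * x} \<le> 2 * exp (- x\<^sup>2 / 4)"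
proof -
  define A where "A = {y :: real. \<bar>y\<bar> > \<sigma> * x}"
  have A: "A \<in> sets lborel" unfolding A_def by measurable
  have "emeasure M {\<omega> \<in> space M. \<bar>Y \<omega>\<bar> > \<sigma> * x} = emeasure M (Y -` A \<inter> space M)"
    by (rule arg_cong[of _ _ "emeasure M"]) (auto simp: A_def)
  also have "\<dots> = (\<integral>\<^sup>+y. ennreal (normal_density 0 \<sigma> y) * indicator A y \<partial>lborel)"
    by (rule distributed_emeasure[OF D A])
  also have "\<dots> \<le> (\<integral>\<^sup>+y. ennreal (2 * exp (- x\<^sup>2 / 4)) * ennreal (normal_density 0 (sqrt 2 * \<sigma>) y) \<partial>lborel)"
  proof (rule nn_integral_mono)
    fix y
    have "normal_density 0 \<sigma> y \<le> 2 * exp (- x\<^sup>2 / 4) * normal_density 0 (sqrt 2 * \<sigma>) y" if "y \<in> A"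
    proof -
      have "(\<sigma> * x)\<^sup>2 \<le> \<bar>y\<bar>\<^sup>2"
        using that x \<sigma> by (intro power_mono) (auto simp: A_def)
      then have "x\<^sup>2 \<le> y\<^sup>2 / \<sigma>\<^sup>2"
        using \<sigma> by (simp add: field_simps)
      then have "- (y\<^sup>2 / (2 * \<sigma>\<^sup>2)) \<le> - x\<^sup>2 / 4 - y\<^sup>2 / (4 * \<sigma>\<^sup>2)"
        by (simp add: field_simps)
      then have "exp (- (y\<^sup>2 / (2 * \<sigma>\<^sup>2))) \<le> exp (- x\<^sup>2 / 4 - y\<^sup>2 / (4 * \<sigma>\<^sup>2))"
        by simp
      also have "\<dots> = exp (- x\<^sup>2 / 4) * exp (- (y\<^sup>2 / (4 * \<sigma>\<^sup>2)))"
        by (simp flip: exp_add)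
      finally have 1: "exp (- (y\<^sup>2 / (2 * \<sigma>\<^sup>2))) \<le> exp (- x\<^sup>2 / 4) * exp (- (y\<^sup>2 / (4 * \<sigma>\<^sup>2)))" .
      have 2: "sqrt (2 * pi * (sqrt 2 * \<sigma>)\<^sup>2) = sqrt 2 * sqrt (2 * pi * \<sigma>\<^sup>2)"
        by (simp add: power_mult_distrib real_sqrt_mult)
      have 3: "sqrt 2 \<le> (2 :: real)"
        by (rule real_le_lsqrt) auto
      have "normal_density 0 \<sigma> y \<le> exp (- x\<^sup>2 / 4) * exp (- (y\<^sup>2 / (4 * \<sigma>\<^sup>2))) / sqrt (2 * pi * \<sigma>\<^sup>2)"
        using divide_right_mono[OF 1, of "sqrt (2 * pi * \<sigma>\<^sup>2)"] by (simp add: normal_density_def)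
      also have "\<dots> = sqrt 2 * (exp (- x\<^sup>2 / 4) * normal_density 0 (sqrt 2 * \<sigma>) y)"
        unfolding normal_density_def 2 by (simp add: power_mult_distrib)
      also have "\<dots> \<le> 2 * (exp (- x\<^sup>2 / 4) * normal_density 0 (sqrt 2 * \<sigma>) y)"
        using 3 by (rule mult_right_mono) simp
      finally show ?thesis by simp
    qed
    then show "ennreal (normal_density 0 \<sigma> y) * indicator A y
        \<le> ennreal (2 * exp (- x\<^sup>2 / 4)) * ennreal (normal_density 0 (sqrt 2 * \<sigma>) y)"
      by (auto simp: indicator_def ennreal_mult[symmetric] intro!: ennreal_leI)
  qed
  also have "\<dots> = ennreal (2 * exp (- x\<^sup>2 / 4))"
    using \<sigma> integral_normal_density[of "sqrt 2 * \<sigma>" 0] integrable_normal_density[of "sqrt 2 * \<sigma>" 0]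
    by (subst nn_integral_cmult) (auto simp: nn_integral_eq_integral)
  finally show ?thesis
    by (simp add: emeasure_eq_measure)
qed

text \<open>The increment is the two-point linear combination with coefficients 1 and -1, and the
  covariance gives it variance \<open>(t - s) powr (2 * H)\<close>.\<close>

lemma fbm_increment_tail:
  assumes fbm: "is_fbm M H B" and "0 \<le> s" "s < t" "x \<ge> 0"
  shows "measure M {\<omega> \<in> space M. \<bar>B t \<omega> - B s \<omega>\<bar> > (t - s) powr H * x} \<le> 2 * exp (- x\<^sup>2 / 4)"
proof -
  interpret prob_space M using fbm by (simp add: is_fbm_def)
  define ts where "ts = (\<lambda>i::nat. if i = 0 then t else s)"
  define cs where "cs = (\<lambda>i::nat. if i = 0 then 1 else -1 :: real)"
  have "gaussian_rv M (\<lambda>\<omega>. \<Sum>i<2. cs i * B (ts i) \<omega>) 0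
          (\<Sum>i<2. \<Sum>j<2. cs i * cs j * fbm_cov H (ts i) (ts j))"
    using fbm assms by (simp add: is_fbm_def ts_def)
  moreover have "(\<lambda>\<omega>. \<Sum>i<2. cs i * B (ts i) \<omega>) = (\<lambda>\<omega>. B t \<omega> - B s \<omega>)"
    by (simp add: numeral_2_eq_2 ts_def cs_def)
  moreover have "(\<Sum>i<2. \<Sum>j<2. cs i * cs j * fbm_cov H (ts i) (ts j)) = (t - s) powr (2 * H)"
    using assms by (simp add: numeral_2_eq_2 ts_def cs_def fbm_cov_def field_simps abs_minus_commute)
  moreover have "sqrt ((t - s) powr (2 * H)) = (t - s) powr H"
    by (simp add: powr_half_sqrt[symmetric] powr_powr)
  ultimately have "distributed M lborel (\<lambda>\<omega>. B t \<omega> - B s \<omega>) (normal_density 0 ((t - s) powr H))"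
    using assms by (simp add: gaussian_rv_def)
  from normal_tail[OF this _ assms(4)] assms show ?thesis by simp
qed

section \<open>Union bound over dyadic levels and horizons\<close>

text \<open>Level \<open>n\<close> has \<open>2 ^ n\<close> intervals, and this count must be beaten
  by the tail. One term of the exponential series gives
  \<open>exp (- z) \<le> fact k / z ^ k\<close>; taking \<open>k \<ge> 2 / \<delta>\<close> makes
  this at most a constant times \<open>(1 / 4) ^ n\<close>.\<close>

lemma summable_pow2_exp_neg:
  fixes \<delta> c :: real
  assumes "\<delta> > 0" "c > 0"
  shows "summable (\<lambda>n::nat. 2 ^ n * exp (- c * 2 powr (\<delta> * n)))"
proof -
  obtain k :: nat where k: "k \<ge> 2 / \<delta>" using real_arch_simple by blast
  define C where "C = fact k / c ^ k"
  have "2 ^ n * exp (- c * 2 powr (\<delta> * n)) \<le> C * (1 / 2) ^ n" for n :: nat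
  proof -
    define z where "z = c * 2 powr (\<delta> * n)"
    have z: "z > 0" using assms by (simp add: z_def)
    have "z ^ k / fact k \<le> exp z"
    proof -
      have "(\<Sum>i\<in>{k}. z ^ i /\<^sub>R fact i) \<le> exp z"
        unfolding exp_def using z by (intro sum_le_suminf summable_exp_generic) auto
      then show ?thesis by (simp add: field_simps)
    qed
    then have "exp (- z) \<le> fact k / z ^ k"
      using z by (simp add: exp_minus field_simps)
    also have "\<dots> = C * 2 powr (- \<delta> * n * k)"
      using assms by (simp add: z_def C_def power_mult_distrib powr_power powr_minus field_simps)
    also have "\<dots> \<le> C * 2 powr (- 2 * n)"
    proof -
      have "2 \<le> \<delta> * k" using k assms by (simp add: field_simps)
      then have "2 * real n \<le> \<delta> * k * n" by (rule mult_right_mono) simp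
      then show ?thesis using assms by (intro mult_left_mono powr_mono) (auto simp: C_def mult_ac)
    qed
    also have "2 powr (- 2 * n) = (1 / 4 :: real) ^ n"
    proof -
      have "(2 :: real) powr - 2 = 1 / 4" by (simp add: powr_minus_divide)
      moreover have "2 powr (- 2 * n) = (2 powr - 2 :: real) ^ n"
        by (simp add: powr_power mult.commute)
      ultimately show ?thesis by metis
    qed
    finally have "2 ^ n * exp (- z) \<le> C * (2 ^ n * (1 / 4) ^ n)"
      by (simp add: mult_left_mono)
    also have "2 ^ n * (1 / 4 :: real) ^ n = (1 / 2) ^ n"
      by (simp flip: power_mult_distrib)
    finally show ?thesis by (simp add: z_def)
  qed
  then have "norm (2 ^ n * exp (- c * 2 powr (\<delta> * n))) \<le> C * (1 / 2) ^ n" for n :: nat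
    by (simp add: abs_mult)
  moreover have "summable (\<lambda>n. C * (1 / 2) ^ n)"
    by (intro summable_mult summable_geometric) simp
  ultimately show ?thesis
    by (rule summable_comparison_test'[rotated])
qed

text \<open>The thresholds grow in \<open>n\<close> to outweigh the \<open>2 ^ n\<close> intervals
  of a level, and in \<open>m\<close> to make the sum over horizons converge:
  \<open>p \<ge> 1 / 2\<close> gives \<open>(m + 1) powr (2 * p) \<ge> m + 1\<close>, hence
  geometric decay. The Gaussian factor in \<open>x\<close> then comes out of the double sum.\<close>

lemma (in prob_space) dyadic_sup_tail:
  fixes Z :: "nat \<Rightarrow> nat \<Rightarrow> nat \<Rightarrow> 'a \<Rightarrow> real" and \<delta> p :: real
  assumes \<delta>: "\<delta> > 0" and p: "p \<ge> 1 / 2"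
    and meas: "\<And>m n k. k < 2 ^ n \<Longrightarrow> random_variable borel (Z m n k)"
    and tail: "\<And>m n k y. k < 2 ^ n \<Longrightarrow> y \<ge> 0 \<Longrightarrow> prob {\<omega> \<in> space M. Z m n k \<omega> > y} \<le> 2 * exp (- y\<^sup>2 / 4)"
  shows "\<exists>K\<ge>0. \<forall>x\<ge>1. prob {\<omega> \<in> space M. \<exists>m n k. k < 2 ^ n \<and> Z m n k \<omega> > x * (2 powr (\<delta> * n) * (m + 1) powr p)}
     \<le> K * exp (- x\<^sup>2 / 12)"
proof -
  define a where "a = (\<lambda>n::nat. 2 ^ n * exp (- (1 / 12) * 2 powr ((2 * \<delta>) * n)))"
  define b where "b = (\<lambda>m::nat. exp (- (1 / 12) * (m + 1) powr (2 * p)))"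
  have a: "summable a" unfolding a_def using \<delta> by (intro summable_pow2_exp_neg) auto
  have b: "summable b"
  proof (rule summable_comparison_test')
    show "summable (\<lambda>m. exp (- (1 / 12 :: real)) ^ m)"
      by (rule summable_geometric) simp
    fix m :: nat
    have "real m \<le> (m + 1) powr 1" by simp
    also have "\<dots> \<le> (m + 1) powr (2 * p)" using p by (intro powr_mono) auto
    finally show "norm (b m) \<le> exp (- (1 / 12)) ^ m"
      by (simp add: b_def add.commute flip: exp_of_nat_mult)
  qed
  have pos: "a n \<ge> 0" "b m \<ge> 0" for m n by (simp_all add: a_def b_def)
  have "prob {\<omega> \<in> space M. \<exists>m n k. k < 2 ^ n \<and> Z m n k \<omega> > x * (2 powr (\<delta> * n) * (m + 1) powr p)}
     \<le> 2 * suminf a * suminf b * exp (- x\<^sup>2 / 12)" if x: "x \<ge> 1" for x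
  proof -
    define y where "y = (\<lambda>m n. x * (2 powr (\<delta> * real n) * (real m + 1) powr p))"
    define E where "E = (\<lambda>m n k. {\<omega> \<in> space M. Z m n k \<omega> > y m n})"
    have E: "E m n k \<in> events" if "k < 2 ^ n" for m n k
      using meas[OF that] unfolding E_def by measurable
    have En: "(\<Union>k<2 ^ n. E m n k) \<in> events" for m n
      using E by (intro sets.finite_UN) auto
    have 1: "prob (\<Union>k<2 ^ n. E m n k) \<le> 2 * exp (- x\<^sup>2 / 12) * b m * a n" for m n
    proof -
      have "prob (\<Union>k<2 ^ n. E m n k) \<le> (\<Sum>k<2^n. prob (E m n k))"
        using E by (intro finite_measure_subadditive_finite) auto
      also have "\<dots> \<le> (\<Sum>k<(2::nat)^n. 2 * exp (- (y m n)\<^sup>2 / 4))"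
        unfolding E_def using x by (intro sum_mono tail) (auto simp: y_def)
      also have "\<dots> = 2 ^ n * (2 * exp (- (y m n)\<^sup>2 / 4))"
        by simp
      also have "\<dots> \<le> 2 ^ n * (2 * exp (- x\<^sup>2 / 12 - (1 / 12) * (m + 1) powr (2 * p) - (1 / 12) * 2 powr ((2 * \<delta>) * n)))"
      proof -
        \<comment> \<open>The squared threshold is a product of three factors, each at least 1, so
          it dominates their average. This separates the exponential into one factor for each of
          \<open>x\<close>, \<open>m\<close> and \<open>n\<close>, with rate 1/12 = 1/4 *
          1/3.\<close>
        define u where "u = x\<^sup>2"
        define v where "v = 2 powr ((2 * \<delta>) * n)"
        define w where "w = (real m + 1) powr (2 * p)"
        have ge1: "u \<ge> 1" "v \<ge> 1" "w \<ge> 1"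
          using x \<delta> p by (auto simp: u_def v_def w_def intro!: ge_one_powr_ge_zero)
        have "(y m n)\<^sup>2 = u * (v * w)"
          by (simp add: y_def u_def v_def w_def power_mult_distrib powr_power mult_ac)
        moreover have "u \<le> u * (v * w)" "v \<le> u * (v * w)" "w \<le> u * (v * w)"
          using ge1 mult_mono[of 1 v 1 w] mult_mono[of 1 u 1 w] mult_mono[of 1 u 1 v]
            mult_left_mono[of 1 "v * w" u] mult_left_mono[of 1 "u * w" v] mult_left_mono[of 1 "u * v" w]
          by (auto simp: mult_ac)
        ultimately have "u + v + w \<le> 3 * (y m n)\<^sup>2"
          by simp
        then show ?thesis by (simp add: u_def v_def w_def add.commute)
      qed
      also have "\<dots> = 2 * exp (- x\<^sup>2 / 12) * b m * a n"
      proof -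
        have "exp (r - s - t) = exp r * exp (- s) * exp (- t)" for r s t :: real
          by (simp flip: exp_add)
        then show ?thesis by (simp add: a_def b_def add.commute)
      qed
      finally show ?thesis .
    qed
    have sm: "summable (\<lambda>n. 2 * exp (- x\<^sup>2 / 12) * b m * a n)" for m
      using a by (rule summable_mult)
    have 2: "prob (\<Union>n. \<Union>k<2 ^ n. E m n k) \<le> 2 * exp (- x\<^sup>2 / 12) * suminf a * b m" for m
    proof -
      have s: "summable (\<lambda>n. prob (\<Union>k<2 ^ n. E m n k))"
        using 1 by (intro summable_comparison_test'[OF sm]) auto
      have "prob (\<Union>n. \<Union>k<2 ^ n. E m n k) \<le> (\<Sum>n. prob (\<Union>k<2 ^ n. E m n k))"
        using En s by (intro finite_measure_subadditive_countably) auto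
      also have "\<dots> \<le> (\<Sum>n. 2 * exp (- x\<^sup>2 / 12) * b m * a n)"
        using 1 s sm by (intro suminf_le) auto
      also have "\<dots> = 2 * exp (- x\<^sup>2 / 12) * b m * suminf a"
        using a by (rule suminf_mult)
      finally show ?thesis by (simp add: mult_ac)
    qed
    have sm': "summable (\<lambda>m. 2 * exp (- x\<^sup>2 / 12) * suminf a * b m)"
      using b by (rule summable_mult)
    have s: "summable (\<lambda>m. prob (\<Union>n. \<Union>k<2 ^ n. E m n k))"
      using 2 by (intro summable_comparison_test'[OF sm']) auto
    have "prob (\<Union>m. \<Union>n. \<Union>k<2 ^ n. E m n k) \<le> (\<Sum>m. prob (\<Union>n. \<Union>k<2 ^ n. E m n k))"
      using En s by (intro finite_measure_subadditive_countably) auto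
    also have "\<dots> \<le> (\<Sum>m. 2 * exp (- x\<^sup>2 / 12) * suminf a * b m)"
      using 2 s sm' by (intro suminf_le) auto
    also have "\<dots> = 2 * exp (- x\<^sup>2 / 12) * suminf a * suminf b"
      using b by (rule suminf_mult)
    also have "(\<Union>m. \<Union>n. \<Union>k<2 ^ n. E m n k)
      = {\<omega> \<in> space M. \<exists>m n k. k < 2 ^ n \<and> Z m n k \<omega> > x * (2 powr (\<delta> * n) * (m + 1) powr p)}"
      by (auto simp: E_def y_def add.commute)
    finally show ?thesis by (simp add: mult_ac)
  qed
  moreover have "2 * suminf a * suminf b \<ge> 0"
    using a b pos by (simp add: suminf_nonneg)
  ultimately show ?thesis by blast
qed

section \<open>Normal form of the tail bound\<close>

text \<open>The numbers \<open>3\<close>, \<open>2 / 3\<close> and \<open>1 / 3\<close> are \<open>2 C\<^sub>1 + 1\<close>, \<open>2 \<gamma> / (2 \<gamma> + \<kappa>)\<close> and \<open>\<kappa> / (2 \<gamma> + \<kappa>)\<close> for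
  \<open>C\<^sub>1 = 1\<close> and \<open>\<gamma> = \<kappa> = 1 / 2\<close>. For this choice \<open>\<bar>\<epsilon> - 3 \<epsilon>\<^bsup>1/3\<^esup>\<bar> \<le> \<epsilon>\<close> holds beyond the threshold.\<close>
lemma gaussian_tail_renormalize:
  fixes F :: "real \<Rightarrow> real"
  assumes F1: "\<And>\<epsilon>. F \<epsilon> \<le> 1" and c: "c > 0" and K: "K \<ge> 0"
    and tail: "\<And>\<epsilon>. \<epsilon> \<ge> \<epsilon>\<^sub>0 \<Longrightarrow> F \<epsilon> \<le> K * exp (- c * \<epsilon>\<^sup>2)"
  shows "\<exists>b>0. \<forall>\<epsilon> > 3 powr (2 / 3). F \<epsilon> \<le> 2 * exp (- ((\<epsilon> - \<epsilon> powr (1 / 3) * 3)\<^sup>2 / (2 * b\<^sup>2)))"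
proof -
  \<comment> \<open>Beyond \<open>R\<close>, half of the rate \<open>c\<close> absorbs the factor
    \<open>K\<close>, and \<open>b \<ge> 1 / sqrt c\<close> puts the required rate below the other
    half. Below \<open>R\<close>, the choice \<open>b \<ge> |R|\<close> keeps the right-hand side at
    least 1, so the trivial bound \<open>F1\<close> is enough.\<close>
  define R where "R = max \<epsilon>\<^sub>0 (sqrt (2 * K / c))"
  define b where "b = max 1 (max \<bar>R\<bar> (1 / sqrt c))"
  have b: "b \<ge> 1" "\<bar>R\<bar> \<le> b" "1 / sqrt c \<le> b"
    unfolding b_def by auto
  have bR: "R\<^sup>2 \<le> b\<^sup>2"
    using b power_mono[of "\<bar>R\<bar>" b 2] by simp
  have "(1 / sqrt c)\<^sup>2 \<le> b\<^sup>2"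
    using b c by (intro power_mono) auto
  then have bc: "1 / (2 * b\<^sup>2) \<le> c / 2"
    using c b by (simp add: power_divide field_simps)
  have F: "F \<epsilon> \<le> 2 * exp (- (\<epsilon>\<^sup>2 / (2 * b\<^sup>2)))" if \<epsilon>: "\<epsilon> \<ge> 0" for \<epsilon>
  proof (cases "\<epsilon> \<ge> R")
    case True
    have "sqrt (2 * K / c) \<le> \<epsilon>" using True by (simp add: R_def)
    then have "2 * K / c \<le> \<epsilon>\<^sup>2"
      using K c by (metis sqrt_le_D)
    then have "K \<le> c * \<epsilon>\<^sup>2 / 2" using c by (simp add: field_simps)
    also have "\<dots> \<le> exp (c * \<epsilon>\<^sup>2 / 2)"
      using exp_ge_add_one_self[of "c * \<epsilon>\<^sup>2 / 2"] by linarith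
    finally have "K \<le> exp (c * \<epsilon>\<^sup>2 / 2)" .
    then have "K * exp (- c * \<epsilon>\<^sup>2) \<le> exp (c * \<epsilon>\<^sup>2 / 2) * exp (- c * \<epsilon>\<^sup>2)"
      by (rule mult_right_mono) simp
    also have "\<dots> = exp (- (\<epsilon>\<^sup>2 * (c / 2)))"
      by (simp flip: exp_add)
    also have "\<dots> \<le> exp (- (\<epsilon>\<^sup>2 * (1 / (2 * b\<^sup>2))))"
      using mult_left_mono[OF bc, of "\<epsilon>\<^sup>2"] by simp
    finally have "K * exp (- c * \<epsilon>\<^sup>2) \<le> exp (- (\<epsilon>\<^sup>2 / (2 * b\<^sup>2)))" by simp
    moreover have "F \<epsilon> \<le> K * exp (- c * \<epsilon>\<^sup>2)"
      using True by (intro tail) (simp add: R_def)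
    moreover have "0 \<le> exp (- (\<epsilon>\<^sup>2 / (2 * b\<^sup>2)))" by simp
    ultimately show ?thesis by linarith
  next
    case False
    then have "\<epsilon>\<^sup>2 \<le> R\<^sup>2" using \<epsilon> by (intro power_mono) auto
    then have "\<epsilon>\<^sup>2 / (2 * b\<^sup>2) \<le> 1 / 2"
      using bR b by (simp add: field_simps)
    then have "1 / 2 \<le> exp (- (\<epsilon>\<^sup>2 / (2 * b\<^sup>2)))"
      using exp_ge_add_one_self[of "- (\<epsilon>\<^sup>2 / (2 * b\<^sup>2))"] by linarith
    then show ?thesis using F1[of \<epsilon>] by linarith
  qed
  have "F \<epsilon> \<le> 2 * exp (- ((\<epsilon> - \<epsilon> powr (1 / 3) * 3)\<^sup>2 / (2 * b\<^sup>2)))" if \<epsilon>: "\<epsilon> > 3 powr (2 / 3)" for \<epsilon>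
  proof -
    define z where "z = \<epsilon> powr (1 / 3)"
    have e1: "\<epsilon> > 0" using \<epsilon> by (meson less_trans powr_gt_zero zero_less_numeral less_le_trans not_le powr_ge_zero)
    have z: "\<epsilon> = z ^ 3" "z > 0" using e1 by (simp_all add: z_def powr_power)
    have "3 powr (2 / 9) = (3 powr (2 / 3)) powr (1 / 3 :: real)" by (simp add: powr_powr)
    also have "\<dots> \<le> z" unfolding z_def using \<epsilon> by (intro powr_mono2) auto
    finally have "(3 powr (2 / 9)) ^ 9 \<le> z ^ 9" by (intro power_mono) auto
    then have "9 \<le> z ^ 9" by (simp add: powr_power)
    \<comment> \<open>As \<epsilon> is the cube of \<open>z\<close>, this is what
      \<open>3 * z \<le> 2 * \<epsilon>\<close> requires. It follows from
      \<open>z ^ 18 \<ge> 81\<close>, since \<open>(3 / 2) ^ 9\<close> is below 39.\<close>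
    have "3 / 2 \<le> z\<^sup>2"
    proof (rule ccontr)
      assume "\<not> ?thesis"
      then have "(z\<^sup>2) ^ 9 < (3 / 2) ^ 9" by (intro power_strict_mono) auto
      moreover have "9 ^ 2 \<le> (z ^ 9) ^ 2" using \<open>9 \<le> z ^ 9\<close> by (intro power_mono) auto
      ultimately show False by (simp add: field_simps)
    qed
    then have "z * 3 \<le> 2 * \<epsilon>"
      using mult_left_mono[of "3/2" "z\<^sup>2" z] z by (simp add: power3_eq_cube power2_eq_square)
    then have "\<bar>\<epsilon> - z * 3\<bar> \<le> \<epsilon>" using z(2) by linarith
    then have "(\<epsilon> - z * 3)\<^sup>2 \<le> \<epsilon>\<^sup>2" using e1 by (simp add: abs_le_square_iff[symmetric])
    then have "exp (- (\<epsilon>\<^sup>2 / (2 * b\<^sup>2))) \<le> exp (- ((\<epsilon> - z * 3)\<^sup>2 / (2 * b\<^sup>2)))"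
      by (simp add: divide_right_mono)
    then show ?thesis using F[of \<epsilon>] e1 unfolding z_def by linarith
  qed
  moreover have "b > 0" using b by simp
  ultimately show ?thesis by blast
qed

section \<open>Choice of the dyadic horizon\<close>

text \<open>For \<open>t \<le> 2\<close> take \<open>m = 0\<close>; the maximum with 1 covers this
  case, including the zero of the logarithm at 1. Otherwise
  \<open>2 ^ m \<le> t < 2 ^ (m + 1)\<close> with \<open>m \<ge> 1\<close>: the horizon is at most
  \<open>2 * t\<close>, and \<open>m + 1 \<le> 2 * m \<le> 4 * ln t\<close> because
  \<open>ln 2 \<ge> 1 / 2\<close>. These give the factors 2 and \<open>4 powr p\<close>.\<close>

lemma exists_dyadic_horizon:
  fixes t a p :: real
  assumes t: "t > 0" and a: "0 < a" "a \<le> 1" and p: "p \<ge> 0"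
  shows "\<exists>m::nat. t \<le> 2 ^ (m + 1) \<and>
    (m + 1) powr p * (2 ^ (m + 1)) powr a \<le> 2 * 4 powr p * max (t powr a * \<bar>ln t\<bar> powr p) 1"
proof (cases "t \<le> 2")
  case True
  have "2 powr a \<le> 2 powr 1" using a by (intro powr_mono) auto
  also have "2 powr 1 \<le> 2 * 4 powr p * (1 :: real)"
    using p ge_one_powr_ge_zero[of 4 p] by simp
  also have "\<dots> \<le> 2 * 4 powr p * max (t powr a * \<bar>ln t\<bar> powr p) 1"
    by (intro mult_left_mono) auto
  finally show ?thesis using True by (intro exI[of _ 0]) simp
next
  case False
  have "\<exists>n::nat. t < 2 ^ n" by (rule real_arch_pow) simp
  then obtain l where l: "t < 2 ^ l" "\<And>i. i < l \<Longrightarrow> \<not> t < 2 ^ i"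
    using exists_least_iff[of "\<lambda>n. t < 2 ^ n"] by blast
  have "l \<noteq> 0" using l(1) False by (cases l) auto
  moreover have "l \<noteq> 1" using l(1) False by auto
  ultimately obtain m where m: "l = m + 1" "m \<ge> 1"
    by (metis Suc_eq_plus1 One_nat_def Suc_le_eq gr0_conv_Suc neq0_conv)
  have lo: "2 ^ m \<le> t" using l(2)[of m] m by simp
  have "(2 ^ (m + 1)) powr a \<le> (2 * t) powr a"
    using lo a by (intro powr_mono2) auto
  also have "\<dots> = 2 powr a * t powr a" using t by (simp add: powr_mult)
  also have "\<dots> \<le> 2 powr 1 * t powr a"
    using a by (intro mult_right_mono powr_mono) auto
  finally have A: "(2 ^ (m + 1)) powr a \<le> 2 * t powr a" by simp
  have "m * ln 2 = ln (2 ^ m :: real)" by (simp add: ln_realpow)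
  also have "\<dots> \<le> ln t" using lo t by simp
  finally have "m * ln 2 \<le> ln t" .
  moreover have "m * (1 / 2) \<le> m * ln (2 :: real)"
    using ln2_ge_two_thirds by (intro mult_left_mono) auto
  ultimately have "real (m + 1) \<le> 4 * \<bar>ln t\<bar>" using m(2) by linarith
  then have "(m + 1) powr p \<le> (4 * \<bar>ln t\<bar>) powr p"
    using p by (intro powr_mono2) auto
  then have "(m + 1) powr p \<le> 4 powr p * \<bar>ln t\<bar> powr p" by (simp add: powr_mult)
  then have "(m + 1) powr p * (2 ^ (m + 1)) powr a \<le> 4 powr p * \<bar>ln t\<bar> powr p * (2 * t powr a)"
    using A by (intro mult_mono) auto
  also have "\<dots> = 2 * 4 powr p * (t powr a * \<bar>ln t\<bar> powr p)" by simp
  also have "\<dots> \<le> 2 * 4 powr p * max (t powr a * \<bar>ln t\<bar> powr p) 1"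
    by (intro mult_left_mono) auto
  finally show ?thesis using l(1) m by (intro exI[of _ m]) simp
qed

section \<open>Construction of the random variable and assembly\<close>

theorem theorem3p4:
  fixes M :: "'a measure" and H \<alpha> :: real and B :: "real \<Rightarrow> 'a \<Rightarrow> real"
  assumes "0 < H" "H < 1" "1 - H < \<alpha>" "\<alpha> < 1"
    and "is_fbm M H B"
  shows "\<forall>p>1. \<exists>\<xi> :: 'a \<Rightarrow> ereal.
     \<xi> \<in> borel_measurable M \<and>
     (\<forall>\<omega>\<in>space M. \<forall>t1 t2. 0 \<le> t2 \<and> t2 < t1 \<longrightarrow>
        ereal \<bar>fbm_X \<alpha> B t1 t2 \<omega>\<bar> \<le> ereal (max (t1 powr (H + \<alpha> - 1) * \<bar>ln t1\<bar> powr p) 1) * \<xi> \<omega>) \<and>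
     (\<exists>B1 C1 \<gamma> \<kappa> :: real. B1 > 0 \<and> C1 > 0 \<and> \<gamma> > 0 \<and> 0 < \<kappa> \<and> \<kappa> < 1 \<and> \<kappa> < 2 * \<gamma> \<and>
        (\<forall>\<epsilon>. \<epsilon> > (2 * C1 + 1) powr (2 * \<gamma> / (2 * \<gamma> + \<kappa>)) \<longrightarrow>
           measure M {\<omega> \<in> space M. \<xi> \<omega> > ereal \<epsilon>}
             \<le> 2 * exp (- ((\<epsilon> - \<epsilon> powr (\<kappa> / (2 * \<gamma> + \<kappa>)) * (2 * C1 + 1))\<^sup>2 / (2 * B1\<^sup>2)))))"
proof (intro allI impI)
  fix p :: real
  assume p: "p > 1"
  interpret prob_space M using assms by (simp add: is_fbm_def)
  have B_meas: "B t \<in> borel_measurable M" if "t \<ge> 0" for t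
    using assms that by (simp add: is_fbm_def)
  \<comment> \<open>Half of the available exponent is given up as Hoelder regularity, which places
    \<beta> midway between 1 - \<alpha> and \<open>H\<close>.\<close>
  define \<delta> where "\<delta> = (H + \<alpha> - 1) / 2"
  define \<beta> where "\<beta> = H - \<delta>"
  have \<delta>: "\<delta> > 0" and \<beta>: "\<beta> > 0" and \<beta>\<delta>: "\<beta> + \<alpha> - 1 = \<delta>" "\<beta> + \<alpha> > 1"
    using assms by (auto simp: \<delta>_def \<beta>_def field_simps)
  have \<delta>2: "2 * \<delta> = H + \<alpha> - 1"
    by (simp add: \<delta>_def)
  define T where "T = (\<lambda>m::nat. 2 ^ (m + 1) :: real)"
  have T: "T m > 0" for m by (simp add: T_def)
  define Z where "Z = (\<lambda>m n k \<omega>. \<bar>B (T m * ((real k + 1) / 2 ^ n)) \<omega> - B (T m * (real k / 2 ^ n)) \<omega>\<bar>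
     / (T m / 2 ^ n) powr H)"
  define w where "w = (\<lambda>(m::nat) (n::nat). 2 powr (\<delta> * n) * (m + 1) powr p)"
  have w: "w m n > 0" for m n by (simp add: w_def)
  define I where "I = {(m::nat, n::nat, k::nat). k < 2 ^ n}"
  \<comment> \<open>The supremum is countable, hence measurable, and extended real values allow it
    to be infinite on some paths.\<close>
  define S where "S = (\<lambda>\<omega>. SUP (m, n, k)\<in>I. ereal (Z m n k \<omega> / w m n))"
  define q where "q = 2 powr - \<beta>"
  have q: "0 < q" "q < 1"
    using \<beta> powr_less_cancel_iff[of 2 "-\<beta>" 0] by (auto simp: q_def)
  define A where "A = (1 + 2 / (1 - q)) * 2 powr \<beta>"
  have A: "A > 0" using q by (auto simp: A_def intro!: mult_pos_pos add_pos_pos)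
  \<comment> \<open>The factors are the chaining constant, the constant of
    \<open>abs_fbm_X_le\<close>, and that of \<open>exists_dyadic_horizon\<close>.\<close>
  define C where "C = A * (1 + 1 / \<delta>) * (2 * 4 powr p)"
  have C: "C > 0" using A \<delta> by (auto simp: C_def intro!: mult_pos_pos add_pos_pos)
  have Z_meas: "Z m n k \<in> borel_measurable M" for m n k
    unfolding Z_def using T[of m]
    by (intro borel_measurable_divide borel_measurable_abs borel_measurable_diff B_meas) auto
  have Z_tail: "prob {\<omega> \<in> space M. Z m n k \<omega> > y} \<le> 2 * exp (- y\<^sup>2 / 4)" if y: "y \<ge> 0" for m n k y
  proof -
    define s where "s = T m * (real k / 2 ^ n)"
    define t where "t = T m * ((real k + 1) / 2 ^ n)"
    have ts: "t - s = T m / 2 ^ n" by (simp add: s_def t_def field_simps)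
    have pos: "T m / 2 ^ n > 0" using T by simp
    then have "s < t" using ts by linarith
    moreover have "s \<ge> 0" using T[of m] by (simp add: s_def)
    ultimately have "prob {\<omega> \<in> space M. \<bar>B t \<omega> - B s \<omega>\<bar> > (t - s) powr H * y} \<le> 2 * exp (- y\<^sup>2 / 4)"
      using assms y by (intro fbm_increment_tail) auto
    also have "{\<omega> \<in> space M. \<bar>B t \<omega> - B s \<omega>\<bar> > (t - s) powr H * y} = {\<omega> \<in> space M. Z m n k \<omega> > y}"
      using pos T[of m] unfolding ts by (auto simp: Z_def s_def t_def pos_less_divide_eq mult.commute)
    finally show ?thesis .
  qed
  obtain K where K: "K \<ge> 0" and tail: "\<And>x. x \<ge> 1 \<Longrightarrow>
    prob {\<omega> \<in> space M. \<exists>m n k. k < 2 ^ n \<and> Z m n k \<omega> > x * w m n} \<le> K * exp (- x\<^sup>2 / 12)"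
    using dyadic_sup_tail[of \<delta> p Z, OF \<delta> _ Z_meas Z_tail] p unfolding w_def by auto
  define \<xi> where "\<xi> = (\<lambda>\<omega>. ereal C * S \<omega>)"
  have "S \<in> borel_measurable M"
    unfolding S_def split_def using Z_meas
    by (intro borel_measurable_SUP borel_measurable_ereal borel_measurable_divide) auto
  then have \<xi>_meas: "\<xi> \<in> borel_measurable M"
    unfolding \<xi>_def by measurable
  have "\<exists>b>0. \<forall>\<epsilon> > 3 powr (2 / 3). prob {\<omega> \<in> space M. \<xi> \<omega> > ereal \<epsilon>}
      \<le> 2 * exp (- ((\<epsilon> - \<epsilon> powr (1 / 3) * 3)\<^sup>2 / (2 * b\<^sup>2)))"
  proof (rule gaussian_tail_renormalize)
    \<comment> \<open>The union bound holds for \<open>x \<ge> 1\<close>; with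
      \<open>x = \<epsilon> / C\<close> this makes \<open>C\<close> the threshold and
      \<open>1 / (12 * C\<^sup>2)\<close> the rate.\<close>
    fix \<epsilon> assume \<epsilon>: "\<epsilon> \<ge> C"
    have "ereal \<epsilon> < \<xi> \<omega> \<longleftrightarrow> ereal (\<epsilon> / C) < S \<omega>" for \<omega>
      using C by (cases "S \<omega>") (auto simp: \<xi>_def field_simps)
    then have "{\<omega> \<in> space M. \<xi> \<omega> > ereal \<epsilon>} = {\<omega> \<in> space M. \<exists>m n k. k < 2 ^ n \<and> Z m n k \<omega> > \<epsilon> / C * w m n}"
      using w by (auto simp: S_def less_SUP_iff I_def pos_less_divide_eq)
    also have "prob \<dots> \<le> K * exp (- (\<epsilon> / C)\<^sup>2 / 12)"
      using \<epsilon> C by (intro tail) simp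
    finally show "prob {\<omega> \<in> space M. \<xi> \<omega> > ereal \<epsilon>} \<le> K * exp (- (1 / (12 * C\<^sup>2)) * \<epsilon>\<^sup>2)"
      by (simp add: power_divide mult.commute)
  qed (use C K in auto)
  then obtain b where b: "b > 0" "\<And>\<epsilon>. \<epsilon> > 3 powr (2 / 3) \<Longrightarrow> prob {\<omega> \<in> space M. \<xi> \<omega> > ereal \<epsilon>}
      \<le> 2 * exp (- ((\<epsilon> - \<epsilon> powr (1 / 3) * 3)\<^sup>2 / (2 * b\<^sup>2)))"
    by blast
  have bound: "ereal \<bar>fbm_X \<alpha> B t1 t2 \<omega>\<bar> \<le> ereal (max (t1 powr (H + \<alpha> - 1) * \<bar>ln t1\<bar> powr p) 1) * \<xi> \<omega>"
    if \<omega>: "\<omega> \<in> space M" and t: "0 \<le> t2" "t2 < t1" for \<omega> t1 t2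
  proof (cases "S \<omega> = \<infinity>")
    case True
    \<comment> \<open>Positivity of this factor excludes the product of 0 and infinity, so the
      right-hand side is infinite.\<close>
    have "max (t1 powr (H + \<alpha> - 1) * \<bar>ln t1\<bar> powr p) 1 > 0" by simp
    then show ?thesis using True C by (simp add: \<xi>_def del: max_less_iff_conj less_max_iff_disj ereal_max)
  next
    case False
    have S_ge: "ereal (Z m n k \<omega> / w m n) \<le> S \<omega>" if "k < 2 ^ n" for m n k
      unfolding S_def using that by (intro SUP_upper2[of "(m, n, k)"]) (auto simp: I_def)
    \<comment> \<open>A single nonnegative member of the family rules out the value minus
      infinity.\<close>
    have "0 \<le> Z 0 0 0 \<omega> / w 0 0" using w[of 0 0] by (simp add: Z_def)
    then have "S \<omega> \<ge> 0"
      using order_trans[of 0 "ereal (Z 0 0 0 \<omega> / w 0 0)" "S \<omega>"] S_ge[of 0 0 0] by simp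
    then obtain s where s: "S \<omega> = ereal s" "s \<ge> 0"
      using False by (cases "S \<omega>") auto
    obtain m :: nat where m: "t1 \<le> T m" and m_le: "(m + 1) powr p * T m powr (2 * \<delta>)
        \<le> 2 * 4 powr p * max (t1 powr (H + \<alpha> - 1) * \<bar>ln t1\<bar> powr p) 1"
      using exists_dyadic_horizon[of t1 "H + \<alpha> - 1" p] t p assms
      unfolding T_def \<delta>2 by auto
    \<comment> \<open>The path on \<open>[0, T m]\<close> is rescaled to the unit interval, where
      chaining applies; \<open>L\<close> collects everything that does not depend on the level
      \<open>n\<close>.\<close>
    define g where "g = (\<lambda>x. B (T m * x) \<omega>)"
    define L where "L = s * (m + 1) powr p * T m powr H"
    have L: "L \<ge> 0" using s by (simp add: L_def)
    have cont: "continuous_on {0..} (\<lambda>t. B t \<omega>)"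
      using assms \<omega> by (simp add: is_fbm_def)
    have g_cont: "continuous_on {0..1} g"
      unfolding g_def using T[of m]
      by (intro continuous_on_compose2[OF cont] continuous_intros) auto
    have incr: "\<bar>g ((real k + 1) / 2 ^ n) - g (real k / 2 ^ n)\<bar> \<le> L * (2 powr - \<beta>) ^ n" if k: "k < 2 ^ n" for n k
    proof -
      have pos: "(T m / 2 ^ n) powr H > 0" using T[of m] by simp
      have "Z m n k \<omega> / w m n \<le> s" using S_ge[OF k, of m] s by simp
      then have "Z m n k \<omega> \<le> s * w m n" using w[of m n] by (simp add: pos_divide_le_eq)
      then have "\<bar>g ((real k + 1) / 2 ^ n) - g (real k / 2 ^ n)\<bar> \<le> s * w m n * (T m / 2 ^ n) powr H"
        using pos by (simp add: Z_def g_def pos_divide_le_eq)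
      also have "(T m / 2 ^ n) powr H = T m powr H * 2 powr (- H * n)"
        using T[of m] by (simp add: powr_divide powr_minus_divide powr_powr mult.commute flip: powr_realpow)
      also have "s * w m n * (T m powr H * 2 powr (- H * n)) = L * (2 powr (\<delta> * n) * 2 powr (- H * n))"
        by (simp add: w_def L_def mult_ac add.commute)
      \<comment> \<open>The growth allowed by the weight \<open>w\<close> lowers the exponent from
        \<open>H\<close> to \<beta>.\<close>
      also have "2 powr (\<delta> * n) * 2 powr (- H * n) = (2 powr - \<beta> :: real) ^ n"
      proof -
        have "\<delta> * n + - H * n = - \<beta> * n" by (simp add: \<beta>_def algebra_simps)
        then show ?thesis by (simp add: powr_power mult.commute flip: powr_add)
      qed
      finally show ?thesis .
    qed
    \<comment> \<open>Undoing the rescaling divides distances by \<open>T m\<close>, whence the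
      power -\<beta>.\<close>
    define K' where "K' = L * A * T m powr (- \<beta>)"
    have "\<bar>B u \<omega> - B t2 \<omega>\<bar> \<le> K' * (u - t2) powr \<beta>" if u: "u \<in> {t2..t1}" for u
    proof -
      have "\<bar>g (u / T m) - g (t2 / T m)\<bar> \<le> L * A * \<bar>u / T m - t2 / T m\<bar> powr \<beta>"
        unfolding A_def q_def using u t m T[of m]
        by (intro dyadic_increments_imp_holder[OF \<beta> g_cont incr]) auto
      also have "\<bar>u / T m - t2 / T m\<bar> = (u - t2) / T m"
        unfolding diff_divide_distrib[symmetric] using u T[of m] by simp
      also have "((u - t2) / T m) powr \<beta> = (u - t2) powr \<beta> * T m powr (- \<beta>)"
        using u T[of m] by (simp add: powr_divide powr_minus_divide)
      finally show ?thesis using T[of m] by (simp add: g_def K'_def mult_ac)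
    qed
    from abs_fbm_X_le[OF t(2) \<beta>\<delta>(2), of B \<omega> K', OF this]
    have "\<bar>fbm_X \<alpha> B t1 t2 \<omega>\<bar> \<le> K' * (1 + 1 / \<delta>) * (t1 - t2) powr \<delta>"
      unfolding \<beta>\<delta>(1) .
    also have "\<dots> \<le> K' * (1 + 1 / \<delta>) * T m powr \<delta>"
      using t m L A \<delta> by (intro mult_left_mono powr_mono2) (auto simp: K'_def)
    also have "\<dots> = s * A * (1 + 1 / \<delta>) * ((m + 1) powr p * (T m powr H * T m powr (- \<beta>) * T m powr \<delta>))"
      by (simp add: K'_def L_def mult_ac)
    \<comment> \<open>The exponents add up to H - \<beta> + \<delta> = 2 \<delta>, which is the
      exponent \<open>H + \<alpha> - 1\<close> of the claim.\<close>
    also have "T m powr H * T m powr (- \<beta>) * T m powr \<delta> = T m powr (2 * \<delta>)"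
      unfolding powr_add[symmetric] by (simp add: \<beta>_def)
    also have "s * A * (1 + 1 / \<delta>) * ((m + 1) powr p * T m powr (2 * \<delta>))
       \<le> s * A * (1 + 1 / \<delta>) * (2 * 4 powr p * max (t1 powr (H + \<alpha> - 1) * \<bar>ln t1\<bar> powr p) 1)"
      using m_le s A \<delta> by (intro mult_left_mono) auto
    also have "\<dots> = max (t1 powr (H + \<alpha> - 1) * \<bar>ln t1\<bar> powr p) 1 * (C * s)"
      by (simp add: C_def mult_ac)
    finally show ?thesis by (simp add: \<xi>_def s del: ereal_max)
  qed
  have "\<exists>B1 C1 \<gamma> \<kappa> :: real. B1 > 0 \<and> C1 > 0 \<and> \<gamma> > 0 \<and> 0 < \<kappa> \<and> \<kappa> < 1 \<and> \<kappa> < 2 * \<gamma> \<and>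
        (\<forall>\<epsilon>. \<epsilon> > (2 * C1 + 1) powr (2 * \<gamma> / (2 * \<gamma> + \<kappa>)) \<longrightarrow>
           measure M {\<omega> \<in> space M. \<xi> \<omega> > ereal \<epsilon>}
             \<le> 2 * exp (- ((\<epsilon> - \<epsilon> powr (\<kappa> / (2 * \<gamma> + \<kappa>)) * (2 * C1 + 1))\<^sup>2 / (2 * B1\<^sup>2))))"
    \<comment> \<open>The witness \<open>1 / 2\<close> serves for both \<gamma> and
      \<kappa>.\<close>
    using b by (intro exI[of _ b] exI[of _ 1] exI[of _ "1 / 2"]) simp
  with \<xi>_meas bound show "\<exists>\<xi> :: 'a \<Rightarrow> ereal.
     \<xi> \<in> borel_measurable M \<and>
     (\<forall>\<omega>\<in>space M. \<forall>t1 t2. 0 \<le> t2 \<and> t2 < t1 \<longrightarrow>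
        ereal \<bar>fbm_X \<alpha> B t1 t2 \<omega>\<bar> \<le> ereal (max (t1 powr (H + \<alpha> - 1) * \<bar>ln t1\<bar> powr p) 1) * \<xi> \<omega>) \<and>
     (\<exists>B1 C1 \<gamma> \<kappa> :: real. B1 > 0 \<and> C1 > 0 \<and> \<gamma> > 0 \<and> 0 < \<kappa> \<and> \<kappa> < 1 \<and> \<kappa> < 2 * \<gamma> \<and>
        (\<forall>\<epsilon>. \<epsilon> > (2 * C1 + 1) powr (2 * \<gamma> / (2 * \<gamma> + \<kappa>)) \<longrightarrow>
           measure M {\<omega> \<in> space M. \<xi> \<omega> > ereal \<epsilon>}
             \<le> 2 * exp (- ((\<epsilon> - \<epsilon> powr (\<kappa> / (2 * \<gamma> + \<kappa>)) * (2 * C1 + 1))\<^sup>2 / (2 * B1\<^sup>2)))))"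
    by (intro exI[of _ \<xi>]) blast
qed

end
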